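(* Let $J$ be a strongly non-nilpotent complex structure on an $8$-dimensional nilpotent Lie algebra $\mathfrak g$ such that $\dim\mathfrak g_1=1$ and $\dim\mathfrak g_2=5$. Then the pair $(\mathfrak g,J)$ is parametrized as follows: there is a $(1,0)$-basis $\{\omega^1,\omega^2,\omega^3,\omega^4\}$ satisfying the structure equations $$\begin{aligned} d\omega^1 &= 0,\\ d\omega^2 &= A\,\omega^{1\bar 1} -B(\omega^{14}- \omega^{1\bar 4}),\\ d\omega^3 &= F\,\omega^{1\bar 1} -E(\omega^{14}- \omega^{1\bar 4}),\\ d\omega^4 &= L\,\omega^{1\bar 1}+M\,\omega^{1\bar 2}+N\,\omega^{1\bar 3}-\bar{M}\,\omega^{2\bar 1}+i\,s\,\omega^{2\bar 2}+P\,\omega^{2\bar 3}-\bar{N}\,\omega^{3\bar 1}-\bar P\,\omega^{3\bar 2}+i\,t\,\omega^{3\bar 3}, \end{aligned}$$ where $A,B,E,F,L,M,N,P\in\mathbb C$ and $s,t\in\mathbb R$ satisfy the Jacobi identity (equivalently, $d^2=0$). Moreover, in these equations: (i) if $\mathfrak g$ has ascending type $(1,5,8)$, then $\operatorname{Re} L=0$; (ii) if $\mathfrak g$ has ascending type $(1,5,6,8)$, then $\operatorname{Re} L\neq 0$.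
   Context: Lie algebras are real and finite-dimensional. The ascending central series of $\mathfrak g$ is $\mathfrak g_0=\{0\}$, $\mathfrak g_k=\{X\in\mathfrak g \mid [X,\mathfrak g]\subseteq \mathfrak g_{k-1}\}$ for $k\geq 1$. For nilpotent $\mathfrak g$, the nilpotency step $r$ is the smallest integer $r\ge1$ with $\mathfrak g_r=\mathfrak g$, and the ascending type of $\mathfrak g$ is $(\dim\mathfrak g_1,\ldots,\dim\mathfrak g_r)$. A complex structure on $\mathfrak g$ is a linear endomorphism $J$ with $J^2=-\mathrm{Id}$ and $[X,Y]+J[JX,Y]+J[X,JY]-[JX,JY]=0$ for all $X,Y\in\mathfrak g$. Let $\mathfrak a_1(J)=\{X\in\mathfrak g \mid [X,\mathfrak g]=0 \text{ and } [JX,\mathfrak g]=0\}$. $J$ is strongly non-nilpotent (SnN) if $\mathfrak a_1(J)=\{0\}$. The differential of $e\in\mathfrak g^*$ is $de(X,Y)=-e([X,Y])$, extended complex-linearly to $\mathfrak g^*_{\mathbb C}=\mathfrak g^*\otimes\mathbb C$. A $(1,0)$-basis is a basis of the space of $(1,0)$-forms with respect to $J$; the paper's convention is that if $\{X_k,JX_k\}_{k=1}^4$ is a basis of $\mathfrak g$ with dual basis $\{x^k,y^k\}_{k=1}^4$ ($x^k$ dual to $X_k$, $y^k$ dual to $JX_k$), then the forms $x^k-i\,y^k$ are of type $(1,0)$, i.e. $(1,0)$-forms are the $\omega\in\mathfrak g^*_{\mathbb C}$ with $\omega(JX)=-i\,\omega(X)$ for all $X\in\mathfrak g$. Notation: $\omega^{jk}=\omega^j\wedge\omega^k$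 and $\omega^{j\bar k}=\omega^j\wedge\overline{\omega^k}$. *)

theory Defs
  imports "HOL-Analysis.Analysis" "HOL-Library.Function_Algebras"
begin

text \<open>A real Lie algebra is a bracket on a type of class \<open>real_vector\<close>; finite dimension is imposed
  by a hypothesis \<open>dim UNIV = n\<close> with \<open>n > 0\<close> (the library's \<open>dim\<close> of an infinite-dimensional space is 0).\<close>

locale lie_algebra =
  fixes bracket :: "'a::real_vector \<Rightarrow> 'a \<Rightarrow> 'a"
  assumes bilinear_bracket: "bilinear bracket"
    and bracket_self: "bracket X X = 0"
    and jacobi: "bracket X (bracket Y Z) + bracket Y (bracket Z X) + bracket Z (bracket X Y) = 0"

primrec ascending_series :: "('a::real_vector \<Rightarrow> 'a \<Rightarrow> 'a) \<Rightarrow> nat \<Rightarrow> 'a set" where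
  "ascending_series br 0 = {0}"
| "ascending_series br (Suc k) = {X. \<forall>Y. br X Y \<in> ascending_series br k}"

definition nilpotent_lie :: "('a::real_vector \<Rightarrow> 'a \<Rightarrow> 'a) \<Rightarrow> bool" where
  "nilpotent_lie br \<longleftrightarrow> (\<exists>k. ascending_series br k = UNIV)"

definition nilpotency_step :: "('a::real_vector \<Rightarrow> 'a \<Rightarrow> 'a) \<Rightarrow> nat" where
  "nilpotency_step br = (LEAST r. r \<ge> 1 \<and> ascending_series br r = UNIV)"

text \<open>Only meaningful for nilpotent Lie algebras, where the step exists.\<close>

definition ascending_type :: "('a::real_vector \<Rightarrow> 'a \<Rightarrow> 'a) \<Rightarrow> nat list" where
  "ascending_type br = map (\<lambda>k. dim (ascending_series br k)) [1..<Suc (nilpotency_step br)]"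

definition complex_structure :: "('a::real_vector \<Rightarrow> 'a \<Rightarrow> 'a) \<Rightarrow> ('a \<Rightarrow> 'a) \<Rightarrow> bool" where
  "complex_structure br J \<longleftrightarrow> linear J \<and> (\<forall>X. J (J X) = - X) \<and>
     (\<forall>X Y. br X Y + J (br (J X) Y) + J (br X (J Y)) - br (J X) (J Y) = 0)"

definition a1 :: "('a::real_vector \<Rightarrow> 'a \<Rightarrow> 'a) \<Rightarrow> ('a \<Rightarrow> 'a) \<Rightarrow> 'a set" where
  "a1 br J = {X. (\<forall>Y. br X Y = 0) \<and> (\<forall>Y. br (J X) Y = 0)}"

definition strongly_non_nilpotent :: "('a::real_vector \<Rightarrow> 'a \<Rightarrow> 'a) \<Rightarrow> ('a \<Rightarrow> 'a) \<Rightarrow> bool" where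
  "strongly_non_nilpotent br J \<longleftrightarrow> complex_structure br J \<and> a1 br J = {0}"

text \<open>The complexified dual is identified with the \<open>\<real>\<close>-linear maps into \<open>\<complex>\<close>, and the complex
  2- and 3-forms with \<open>\<real>\<close>-multilinear \<open>\<complex>\<close>-valued maps. Function types carry the pointwise
  additive structure; the complex scalar action is supplied here.\<close>

definition cscale :: "complex \<Rightarrow> ('a \<Rightarrow> complex) \<Rightarrow> 'a \<Rightarrow> complex" where
  "cscale c f = (\<lambda>X. c * f X)"

interpretation cform: vector_space cscale
  by unfold_locales (auto simp: cscale_def fun_eq_iff algebra_simps)

definition forms10 :: "('a::real_vector \<Rightarrow> 'a) \<Rightarrow> ('a \<Rightarrow> complex) set" where
  "forms10 J = {w. linear w \<and> (\<forall>X. w (J X) = - \<i> * w X)}"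

definition basis10 ::
  "('a::real_vector \<Rightarrow> 'a) \<Rightarrow> ('a \<Rightarrow> complex) list \<Rightarrow> bool" where
  "basis10 J ws \<longleftrightarrow> distinct ws \<and> cform.independent (set ws) \<and> cform.span (set ws) = forms10 J"

definition form_cnj :: "('a \<Rightarrow> complex) \<Rightarrow> 'a \<Rightarrow> complex" where
  "form_cnj w = (\<lambda>X. cnj (w X))"

text \<open>No factor \<open>1/2\<close> in the wedge product, matching \<open>de(X,Y) = - e[X,Y]\<close>.\<close>

definition wedge :: "('a \<Rightarrow> complex) \<Rightarrow> ('a \<Rightarrow> complex) \<Rightarrow> 'a \<Rightarrow> 'a \<Rightarrow> complex" (infixl "\<^bold>\<and>" 70) where
  "(u \<^bold>\<and> v) X Y = u X * v Y - u Y * v X"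

definition d1 :: "('a \<Rightarrow> 'a \<Rightarrow> 'a) \<Rightarrow> ('a \<Rightarrow> complex) \<Rightarrow> 'a \<Rightarrow> 'a \<Rightarrow> complex" where
  "d1 br w X Y = - w (br X Y)"

text \<open>The Chevalley--Eilenberg differential on 2-forms, i.e. the extension of \<open>d1\<close> as a graded derivation.\<close>

definition d2 :: "('a \<Rightarrow> 'a \<Rightarrow> 'a) \<Rightarrow> ('a \<Rightarrow> 'a \<Rightarrow> complex) \<Rightarrow> 'a \<Rightarrow> 'a \<Rightarrow> 'a \<Rightarrow> complex" where
  "d2 br \<beta> X Y Z = - \<beta> (br X Y) Z + \<beta> (br X Z) Y - \<beta> (br Y Z) X"

definition structure_eqs ::
  "('a \<Rightarrow> 'a \<Rightarrow> 'a) \<Rightarrow> ('a \<Rightarrow> complex) \<Rightarrow> ('a \<Rightarrow> complex) \<Rightarrow> ('a \<Rightarrow> complex) \<Rightarrow> ('a \<Rightarrow> complex) \<Rightarrow>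
   complex \<Rightarrow> complex \<Rightarrow> complex \<Rightarrow> complex \<Rightarrow> complex \<Rightarrow> complex \<Rightarrow> complex \<Rightarrow> complex \<Rightarrow>
   real \<Rightarrow> real \<Rightarrow> bool" where
  "structure_eqs br w1 w2 w3 w4 A B E F L M N P s t \<longleftrightarrow>
    (\<forall>X Y.
      d1 br w1 X Y = 0 \<and>
      d1 br w2 X Y = A * (w1 \<^bold>\<and> form_cnj w1) X Y
                     - B * ((w1 \<^bold>\<and> w4) X Y - (w1 \<^bold>\<and> form_cnj w4) X Y) \<and>
      d1 br w3 X Y = F * (w1 \<^bold>\<and> form_cnj w1) X Y
                     - E * ((w1 \<^bold>\<and> w4) X Y - (w1 \<^bold>\<and> form_cnj w4) X Y) \<and>
      d1 br w4 X Y = L * (w1 \<^bold>\<and> form_cnj w1) X Y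
                     + M * (w1 \<^bold>\<and> form_cnj w2) X Y
                     + N * (w1 \<^bold>\<and> form_cnj w3) X Y
                     - cnj M * (w2 \<^bold>\<and> form_cnj w1) X Y
                     + \<i> * complex_of_real s * (w2 \<^bold>\<and> form_cnj w2) X Y
                     + P * (w2 \<^bold>\<and> form_cnj w3) X Y
                     - cnj N * (w3 \<^bold>\<and> form_cnj w1) X Y
                     - cnj P * (w3 \<^bold>\<and> form_cnj w2) X Y
                     + \<i> * complex_of_real t * (w3 \<^bold>\<and> form_cnj w3) X Y)"

end

theory Submission
  imports Defs
begin

text \<open>Let \<open>Z\<close> span the centre and write \<open>g k\<close> for the terms of the ascending central series. Integrability
  at the central vector \<open>Z\<close> says that \<open>D = ad (J Z)\<close> commutes with \<open>J\<close>, and \<open>D\<close> is not zero because the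
  structure is strongly non-nilpotent. A \<open>J\<close>-invariant subspace of the one-dimensional centre is zero, so
  \<open>J Z\<close> is not in \<open>g 2\<close>, and \<open>D\<close> vanishes on the largest \<open>J\<close>-invariant subspace \<open>V\<close> of \<open>g 2\<close>.

  The heart of the proof is that \<open>V\<close> has the largest possible dimension, four. If \<open>g 2\<close> and its image
  under \<open>J\<close> spanned the whole algebra, integrability would put every bracket into the plane spanned by \<open>Z\<close>
  and \<open>J Z\<close>; but the image of \<open>D\<close> is \<open>J\<close>-invariant and, by nilpotency, meets that plane only in zero, so
  \<open>D\<close> would be zero (\<open>g_2_plus_J_g_2\<close>). Hence the sum of the two five-dimensional spaces is proper, and
  counting dimensions makes \<open>V\<close> large enough to contain two complex lines (\<open>dim_V\<close>).

  These two lines, the line of \<open>Z\<close>, and one more vector \<open>e1\<close> chosen deep in the central series form a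
  complex frame (\<open>adapted_frame\<close>). In it the only brackets outside the centre come from \<open>[e1, J e1]\<close> and
  \<open>[J Z, e1]\<close>, the latter in \<open>V\<close>; all brackets with \<open>V\<close> are real multiples of \<open>Z\<close>, given by a form of
  type \<open>(1,1)\<close>. In the dual \<open>(1,0)\<close>-basis this is the asserted system of equations (\<open>normal_form\<close>).

  The equations then imply that \<open>g 3\<close> is the whole algebra exactly when \<open>Re L = 0\<close>
  (\<open>g_3_full_iff_Re_L\<close>), which separates the two ascending types.\<close>

section \<open>Dimension in a finite-dimensional real vector space\<close>

text \<open>\<^term>\<open>dim\<close> is \<open>0\<close> on an infinite-dimensional space, so a positive dimension of the whole space
  provides the finite basis that the theory of finite-dimensional spaces is parametrized by.\<close>

lemma finite_dim_real_vector:
  assumes "0 < dim (UNIV :: 'a::real_vector set)"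
  obtains B :: "'a::real_vector set" where "finite_dimensional_vector_space (*\<^sub>R) B"
proof -
  obtain B :: "'a set" where B: "B \<subseteq> UNIV" "independent B" "UNIV \<subseteq> span B"
    by (rule real_vector.maximal_independent_subset[of "UNIV :: 'a set"])
  have span: "span B = UNIV" using B(3) by (simp add: top_unique)
  have "dim (UNIV :: 'a set) = card B"
    by (rule real_vector.dim_eq_card) (simp_all add: span B(2))
  then have "finite B" using assms by (simp add: card_gt_0_iff)
  moreover have "\<not> module.dependent (*\<^sub>R) B" using B(2) by (simp add: dependent_raw_def)
  moreover have "module.span (*\<^sub>R) B = UNIV" using span by (simp add: span_raw_def)
  ultimately have "finite_dimensional_vector_space (*\<^sub>R) B"
    by unfold_locales auto
  then show ?thesis using that by blast
qed

lemma dim_sum_Int_real: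
  fixes S T :: "'a::real_vector set"
  assumes "0 < dim (UNIV :: 'a set)" "subspace S" "subspace T"
  shows "dim {x + y |x y. x \<in> S \<and> y \<in> T} + dim (S \<inter> T) = dim S + dim T"
proof -
  obtain B :: "'a set" where "finite_dimensional_vector_space (*\<^sub>R) B"
    using finite_dim_real_vector[OF assms(1)] .
  then interpret fd: finite_dimensional_vector_space "(*\<^sub>R)" B .
  show ?thesis
    using fd.dim_sums_Int[of S T] assms(2,3) by (simp add: dim_raw_def subspace_raw_def)
qed

lemma subspace_UNIV_if_dim:
  fixes S :: "'a::real_vector set"
  assumes "0 < dim (UNIV :: 'a set)" "subspace S" "dim (UNIV :: 'a set) \<le> dim S"
  shows "S = UNIV"
proof -
  obtain B :: "'a set" where "finite_dimensional_vector_space (*\<^sub>R) B"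
    using finite_dim_real_vector[OF assms(1)] .
  then interpret fd: finite_dimensional_vector_space "(*\<^sub>R)" B .
  show ?thesis
    using fd.subspace_dim_equal[of S UNIV] assms(2,3)
      real_vector.subspace_UNIV[unfolded subspace_raw_def]
    by (simp add: dim_raw_def subspace_raw_def del: fd.dim_UNIV)
qed

lemma dim_insert_le:
  fixes S :: "'a::real_vector set"
  assumes "0 < dim (UNIV :: 'a set)"
  shows "dim (insert x S) \<le> dim S + 1"
proof -
  obtain B :: "'a set" where "finite_dimensional_vector_space (*\<^sub>R) B"
    using finite_dim_real_vector[OF assms(1)] .
  then interpret fd: finite_dimensional_vector_space "(*\<^sub>R)" B .
  show ?thesis
    using fd.dim_insert[of x S] by (simp add: dim_raw_def split: if_splits)
qed

section \<open>Linear algebra of an almost complex structure\<close>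

locale almost_complex =
  fixes J :: "'a::real_vector \<Rightarrow> 'a"
  assumes linear_J: "linear J" and J_J [simp]: "J (J X) = - X"
begin

lemmas J_simps [simp] = linear_add[OF linear_J] linear_diff[OF linear_J] linear_neg[OF linear_J]
  linear_cmul[OF linear_J] linear_0[OF linear_J]

lemma forms10_iff: "w \<in> forms10 J \<longleftrightarrow> linear w \<and> (\<forall>X. w (J X) = - \<i> * w X)"
  by (simp add: forms10_def)

text \<open>With \<open>z\<close> acting as \<open>Re z - Im z J\<close>, the opposite of the usual sign, the space is a complex
  vector space on which the complex-linear forms are exactly those in \<^term>\<open>forms10 J\<close>.\<close>

definition cmul :: "complex \<Rightarrow> 'a \<Rightarrow> 'a" where
  "cmul z v = Re z *\<^sub>R v - Im z *\<^sub>R J v"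

lemma form10_cmul:
  assumes "w \<in> forms10 J" shows "w (cmul z v) = z * w v"
proof -
  have lin: "linear w" and J: "w (J v) = - \<i> * w v" using assms by (auto simp: forms10_iff)
  show ?thesis
    by (simp add: cmul_def linear_diff[OF lin] linear_cmul[OF lin] J complex_eq_iff)
qed

lemma cmul_0 [simp]: "cmul 0 v = 0" "cmul z 0 = 0"
  by (simp_all add: cmul_def)

lemma cmul_1 [simp]: "cmul 1 v = v"
  by (simp add: cmul_def)

lemma cmul_minus_ii: "cmul (- \<i>) v = J v"
  by (simp add: cmul_def)

lemma linear_cmul_left: "linear w \<Longrightarrow> linear (\<lambda>X. cmul (w X) v)"
  by (rule linearI) (simp_all add: cmul_def linear_add linear_cmul algebra_simps)

lemma form10_of_real_functional:
  assumes "linear f" shows "(\<lambda>X. Complex (f X) (f (J X))) \<in> forms10 J"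
  unfolding forms10_iff
proof (intro conjI allI)
  show "linear (\<lambda>X. Complex (f X) (f (J X)))"
    by (rule linearI) (simp_all add: linear_add[OF assms] linear_cmul[OF assms] complex_eq_iff)
qed (simp add: complex_eq_iff linear_neg[OF assms])

lemma forms10_separate:
  assumes "\<And>w. w \<in> forms10 J \<Longrightarrow> w X = 0" shows "X = 0"
proof (rule ccontr)
  assume "X \<noteq> 0"
  then obtain f :: "'a \<Rightarrow> real" where "linear f" "f X = 1"
    using linear_independent_extend[of "{X}" "\<lambda>_. 1::real"] by auto
  with assms[OF form10_of_real_functional] show False
    by (metis complex.sel(1) zero_complex.sel(1) zero_neq_one)
qed

text \<open>Modulo a \<open>J\<close>-invariant subspace, \<open>J x = a x\<close> with \<open>a\<close> real would give \<open>- x = a\<^sup>2 x\<close>, so \<open>J x\<close> is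
  never in the span of \<open>x\<close>. Bases adapted to \<open>J\<close> therefore grow by pairs.\<close>

lemma adjoin_J_pair:
  assumes ind: "independent S" and inv: "\<And>y. y \<in> span S \<Longrightarrow> J y \<in> span S"
    and x: "x \<notin> span S"
  shows "independent (insert (J x) (insert x S))"
    and "finite S \<Longrightarrow> card (insert (J x) (insert x S)) = card S + 2"
    and "\<And>y. y \<in> span (insert (J x) (insert x S)) \<Longrightarrow> J y \<in> span (insert (J x) (insert x S))"
proof -
  have Jx: "J x \<notin> span (insert x S)"
  proof
    assume "J x \<in> span (insert x S)"
    then obtain a where a: "J x - a *\<^sub>R x \<in> span S" using real_vector.span_breakdown_eq by blast
    then have "J (J x - a *\<^sub>R x) + a *\<^sub>R (J x - a *\<^sub>R x) \<in> span S"
      using inv span_add span_scale by blast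
    moreover define c where "c = 1 + a\<^sup>2"
    ultimately have "(- c) *\<^sub>R x \<in> span S" by (simp add: algebra_simps power2_eq_square)
    moreover have "c \<noteq> 0" unfolding c_def by (metis add_pos_nonneg less_irrefl zero_le_power2 zero_less_one)
    ultimately show False using x real_vector.span_scale[of "(- c) *\<^sub>R x" S "- inverse c"] by simp
  qed
  show "independent (insert (J x) (insert x S))"
    using ind x Jx by (simp add: real_vector.independent_insertI)
  show "card (insert (J x) (insert x S)) = card S + 2" if "finite S"
  proof -
    have "x \<notin> S" "J x \<notin> insert x S"
      using x Jx real_vector.span_base[of x S] real_vector.span_base[of "J x" "insert x S"] by auto
    then show ?thesis using that by simp
  qed
  fix y assume "y \<in> span (insert (J x) (insert x S))"
  then obtain a b where ab: "y - a *\<^sub>R J x - b *\<^sub>R x \<in> span S"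
    by (auto simp: real_vector.span_breakdown_eq)
  from inv[OF ab] have "J y - (- a) *\<^sub>R x - b *\<^sub>R J x \<in> span S" by simp
  then have "(J y - b *\<^sub>R J x) - (- a) *\<^sub>R x \<in> span S" by (simp add: algebra_simps)
  then show "J y \<in> span (insert (J x) (insert x S))"
    unfolding real_vector.span_breakdown_eq by blast
qed

text \<open>The real coordinate \<open>f\<close> of \<open>e\<close> is the real part of a unique \<open>(1,0)\<close>-form, \<open>f + i f J\<close>. Its
  imaginary part at \<open>b\<close> is \<open>f (J b)\<close>, which explains the conditions on \<open>J b\<close>.\<close>

lemma dual_form10:
  assumes ind: "independent B" and e: "e \<in> B" "J e \<in> B"
  obtains w where "w \<in> forms10 J" "w e = 1"
    "\<And>b. b \<in> B \<Longrightarrow> J b \<in> B \<Longrightarrow> b \<noteq> e \<Longrightarrow> J b \<noteq> e \<Longrightarrow> w b = 0"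
proof -
  obtain f :: "'a \<Rightarrow> real" where f: "linear f" "\<forall>b\<in>B. f b = (if b = e then 1 else 0)"
    using linear_independent_extend[OF ind, of "\<lambda>b. if b = e then 1 else 0"] by auto
  have "e \<noteq> 0" using e ind real_vector.dependent_zero by blast
  have "J e \<noteq> e"
  proof
    assume *: "J e = e"
    then have "e = - e" using J_J[of e] by simp
    then have "(2::real) *\<^sub>R e = 0" by (metis add.right_inverse scaleR_2)
    then show False using \<open>e \<noteq> 0\<close> by simp
  qed
  show ?thesis
  proof (rule that)
    show "(\<lambda>X. Complex (f X) (f (J X))) \<in> forms10 J"
      by (rule form10_of_real_functional) (fact f)
  qed (use f e \<open>J e \<noteq> e\<close> in \<open>auto simp: complex_eq_iff\<close>)
qed

lemma dual_frame:
  assumes ind: "independent (set [J e1, e1, J e2, e2, J e3, e3, J e4, e4])"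
    and card: "card (set [J e1, e1, J e2, e2, J e3, e3, J e4, e4]) = 8"
    and span: "span (set [J e1, e1, J e2, e2, J e3, e3, J e4, e4]) = UNIV"
  obtains w1 w2 w3 w4 where
    "w1 \<in> forms10 J" "w2 \<in> forms10 J" "w3 \<in> forms10 J" "w4 \<in> forms10 J"
    "w1 e1 = 1" "w1 e2 = 0" "w1 e3 = 0" "w1 e4 = 0"
    "w2 e1 = 0" "w2 e2 = 1" "w2 e3 = 0" "w2 e4 = 0"
    "w3 e1 = 0" "w3 e2 = 0" "w3 e3 = 1" "w3 e4 = 0"
    "w4 e1 = 0" "w4 e2 = 0" "w4 e3 = 0" "w4 e4 = 1"
    "\<And>X. X = cmul (w1 X) e1 + cmul (w2 X) e2 + cmul (w3 X) e3 + cmul (w4 X) e4"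
proof -
  let ?B = "set [J e1, e1, J e2, e2, J e3, e3, J e4, e4]"
  have dist: "distinct [J e1, e1, J e2, e2, J e3, e3, J e4, e4]"
    using card by (intro card_distinct) simp
  have B: "e1 \<in> ?B" "J e1 \<in> ?B" "e2 \<in> ?B" "J e2 \<in> ?B" "e3 \<in> ?B" "J e3 \<in> ?B" "e4 \<in> ?B" "J e4 \<in> ?B"
    by simp_all
  obtain w1 where w1: "w1 \<in> forms10 J" "w1 e1 = 1"
    "\<And>b. b \<in> ?B \<Longrightarrow> J b \<in> ?B \<Longrightarrow> b \<noteq> e1 \<Longrightarrow> J b \<noteq> e1 \<Longrightarrow> w1 b = 0"
    using dual_form10[OF ind B(1,2)] by metis
  obtain w2 where w2: "w2 \<in> forms10 J" "w2 e2 = 1"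
    "\<And>b. b \<in> ?B \<Longrightarrow> J b \<in> ?B \<Longrightarrow> b \<noteq> e2 \<Longrightarrow> J b \<noteq> e2 \<Longrightarrow> w2 b = 0"
    using dual_form10[OF ind B(3,4)] by metis
  obtain w3 where w3: "w3 \<in> forms10 J" "w3 e3 = 1"
    "\<And>b. b \<in> ?B \<Longrightarrow> J b \<in> ?B \<Longrightarrow> b \<noteq> e3 \<Longrightarrow> J b \<noteq> e3 \<Longrightarrow> w3 b = 0"
    using dual_form10[OF ind B(5,6)] by metis
  obtain w4 where w4: "w4 \<in> forms10 J" "w4 e4 = 1"
    "\<And>b. b \<in> ?B \<Longrightarrow> J b \<in> ?B \<Longrightarrow> b \<noteq> e4 \<Longrightarrow> J b \<noteq> e4 \<Longrightarrow> w4 b = 0"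
    using dual_form10[OF ind B(7,8)] by metis
  have v1: "w1 e2 = 0" "w1 e3 = 0" "w1 e4 = 0" by (rule w1(3); use dist in force)+
  have v2: "w2 e1 = 0" "w2 e3 = 0" "w2 e4 = 0" by (rule w2(3); use dist in force)+
  have v3: "w3 e1 = 0" "w3 e2 = 0" "w3 e4 = 0" by (rule w3(3); use dist in force)+
  have v4: "w4 e1 = 0" "w4 e2 = 0" "w4 e3 = 0" by (rule w4(3); use dist in force)+
  have lin: "linear w1" "linear w2" "linear w3" "linear w4"
    using w1(1) w2(1) w3(1) w4(1) by (simp_all add: forms10_iff)
  have wJ: "w1 (J x) = - \<i> * w1 x" "w2 (J x) = - \<i> * w2 x" "w3 (J x) = - \<i> * w3 x"
    "w4 (J x) = - \<i> * w4 x" for x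
    using w1(1) w2(1) w3(1) w4(1) by (simp_all add: forms10_iff)
  have "X = cmul (w1 X) e1 + cmul (w2 X) e2 + cmul (w3 X) e3 + cmul (w4 X) e4" for X
  proof (rule linear_eq_on[of "\<lambda>X. X" _ X ?B])
    show "linear (\<lambda>X. cmul (w1 X) e1 + cmul (w2 X) e2 + cmul (w3 X) e3 + cmul (w4 X) e4)"
      by (intro linear_compose_add linear_cmul_left lin)
    fix b assume "b \<in> ?B"
    then show "b = cmul (w1 b) e1 + cmul (w2 b) e2 + cmul (w3 b) e3 + cmul (w4 b) e4"
      by (auto simp: w1(2) w2(2) w3(2) w4(2) v1 v2 v3 v4 wJ cmul_minus_ii)
  qed (simp_all only: span UNIV_I linear_ident)
  then show ?thesis
    using that[OF w1(1) w2(1) w3(1) w4(1) w1(2) v1 v2(1) w2(2) v2(2,3) v3(1,2) w3(2) v3(3) v4 w4(2)]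
    by blast
qed

end

lemma not_in_cspan:
  assumes "a e \<noteq> 0" "\<And>s. s \<in> S \<Longrightarrow> s e = 0"
  shows "a \<notin> cform.span S"
proof
  assume "a \<in> cform.span S"
  then have "a e = 0"
    by (induction rule: cform.span_induct_alt) (auto simp: assms(2) cscale_def)
  with assms(1) show False by simp
qed

lemma (in almost_complex) basis10_of_dual:
  assumes w: "w1 \<in> forms10 J" "w2 \<in> forms10 J" "w3 \<in> forms10 J" "w4 \<in> forms10 J"
    and v1: "w1 e1 = 1" "w1 e2 = 0" "w1 e3 = 0" "w1 e4 = 0"
    and v2: "w2 e1 = 0" "w2 e2 = 1" "w2 e3 = 0" "w2 e4 = 0"
    and v3: "w3 e1 = 0" "w3 e2 = 0" "w3 e3 = 1" "w3 e4 = 0"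
    and v4: "w4 e1 = 0" "w4 e2 = 0" "w4 e3 = 0" "w4 e4 = 1"
    and X: "\<And>X. X = cmul (w1 X) e1 + cmul (w2 X) e2 + cmul (w3 X) e3 + cmul (w4 X) e4"
  shows "basis10 J [w1, w2, w3, w4]"
  unfolding basis10_def
proof (intro conjI)
  show "distinct [w1, w2, w3, w4]"
    using v1 v2 v3 v4 by auto
  show "cform.independent (set [w1, w2, w3, w4])"
  proof -
    have "w1 \<notin> cform.span {w2, w3, w4}" by (rule not_in_cspan[of _ e1]) (use v1 v2 v3 v4 in auto)
    moreover have "w2 \<notin> cform.span {w3, w4}" by (rule not_in_cspan[of _ e2]) (use v2 v3 v4 in auto)
    moreover have "w3 \<notin> cform.span {w4}" by (rule not_in_cspan[of _ e3]) (use v3 v4 in auto)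
    moreover have "w4 \<notin> cform.span {}" by (rule not_in_cspan[of _ e4]) (use v4 in auto)
    ultimately show ?thesis by (simp add: cform.independent_insertI cform.independent_empty)
  qed
  show "cform.span (set [w1, w2, w3, w4]) = forms10 J"
  proof
    have "cform.subspace (forms10 J)"
      by (auto simp: cform.subspace_def forms10_iff cscale_def linear_iff algebra_simps)
    then show "cform.span (set [w1, w2, w3, w4]) \<subseteq> forms10 J"
      using w by (intro cform.span_minimal) auto
    show "forms10 J \<subseteq> cform.span (set [w1, w2, w3, w4])"
    proof
      fix u assume u: "u \<in> forms10 J"
      then have add: "\<And>x y. u (x + y) = u x + u y" by (auto simp: forms10_iff linear_add)
      have "u = cscale (u e1) w1 + cscale (u e2) w2 + cscale (u e3) w3 + cscale (u e4) w4"
      proof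
        fix x
        show "u x = (cscale (u e1) w1 + cscale (u e2) w2 + cscale (u e3) w3 + cscale (u e4) w4) x"
          by (subst X[of x]) (simp add: add form10_cmul[OF u] cscale_def mult.commute)
      qed
      also have "\<dots> \<in> cform.span (set [w1, w2, w3, w4])"
        by (intro cform.span_add cform.span_scale cform.span_base) auto
      finally show "u \<in> cform.span (set [w1, w2, w3, w4])" .
    qed
  qed
qed

section \<open>The ascending central series\<close>

context lie_algebra
begin

lemmas bracket_simps [simp] =
  bilinear_ladd[OF bilinear_bracket] bilinear_radd[OF bilinear_bracket]
  bilinear_lsub[OF bilinear_bracket] bilinear_rsub[OF bilinear_bracket]
  bilinear_lneg[OF bilinear_bracket] bilinear_rneg[OF bilinear_bracket]
  bilinear_lmul[OF bilinear_bracket] bilinear_rmul[OF bilinear_bracket]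
  bilinear_lzero[OF bilinear_bracket] bilinear_rzero[OF bilinear_bracket]
  bracket_self

lemma bracket_skew: "bracket Y X = - bracket X Y"
proof -
  have "bracket (X + Y) (X + Y) = bracket X X + bracket Y X + (bracket X Y + bracket Y Y)"
    by (simp del: bracket_self)
  then have "bracket Y X + bracket X Y = 0" by simp
  then show ?thesis by (simp add: eq_neg_iff_add_eq_0)
qed

lemma subspace_ascending_series: "subspace (ascending_series bracket k)"
  by (induction k) (auto simp: real_vector.subspace_def)

lemma ascending_series_mono:
  assumes "k \<le> l" shows "ascending_series bracket k \<subseteq> ascending_series bracket l"
proof -
  have "ascending_series bracket k \<subseteq> ascending_series bracket (Suc k)" for k
    by (induction k) auto
  then show ?thesis using assms by (rule lift_Suc_mono_le)
qed

text \<open>\<open>d\<^sup>2 = 0\<close> on one-forms is the Jacobi identity.\<close>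

lemma d2_d1_eq_0:
  assumes "linear w" shows "d2 bracket (d1 bracket w) X Y Z = 0"
proof -
  have "d2 bracket (d1 bracket w) X Y Z =
      - w (bracket X (bracket Y Z) + bracket Y (bracket Z X) + bracket Z (bracket X Y))"
    using bracket_skew[of "bracket X Y" Z] bracket_skew[of "bracket X Z" Y] bracket_skew[of "bracket Y Z" X]
      bracket_skew[of X Z]
    by (simp add: d2_def d1_def linear_add[OF assms] linear_neg[OF assms])
  then show ?thesis by (simp add: jacobi linear_0[OF assms])
qed

end

section \<open>The second term of the series is almost invariant under J\<close>

text \<open>A generator \<open>Z\<close> of the centre is a parameter because the derivation \<open>ad (J Z)\<close> governs everything
  that follows.\<close>

locale snn_lie_algebra = lie_algebra br + almost_complex J
  for br :: "'a::real_vector \<Rightarrow> 'a \<Rightarrow> 'a" and J :: "'a \<Rightarrow> 'a" +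
  fixes Z :: 'a
  assumes nijenhuis: "br X Y + J (br (J X) Y) + J (br X (J Y)) - br (J X) (J Y) = 0"
    and nilpotent: "nilpotent_lie br"
    and a1_trivial: "a1 br J = {0}"
    and centre: "ascending_series br 1 = span {Z}"
    and Z_nz: "Z \<noteq> 0"
    and dim_g2: "dim (ascending_series br 2) = 5"
    and dim_g: "dim (UNIV :: 'a set) = 8"
begin

abbreviation g :: "nat \<Rightarrow> 'a set" where "g \<equiv> ascending_series br"

lemma g_SucD: "X \<in> g (Suc k) \<Longrightarrow> br X Y \<in> g k"
  by simp

lemma g_1_iff: "X \<in> g 1 \<longleftrightarrow> (\<forall>Y. br X Y = 0)"
  by simp

lemma br_Z [simp]: "br Z Y = 0" "br Y Z = 0"
proof -
  have "Z \<in> g 1" using centre real_vector.span_base by blast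
  then show "br Z Y = 0" by simp
  then show "br Y Z = 0" using bracket_skew[of Y Z] by simp
qed

lemma g_2_br: "X \<in> g 2 \<Longrightarrow> br X Y \<in> span {Z}"
  using g_SucD[of X 1 Y] by (simp only: Suc_1 centre)

lemma Z_in_g: "k \<ge> 1 \<Longrightarrow> Z \<in> g k"
  using ascending_series_mono[of 1 k] centre real_vector.span_base[of Z "{Z}"] by blast

text \<open>The integrability condition at the central vector \<open>Z\<close>: the derivation \<open>ad (J Z)\<close>, unlike \<open>ad\<close> of a
  general vector, commutes with \<open>J\<close>.\<close>

lemma ad_JZ_J: "br (J Z) (J Y) = J (br (J Z) Y)"
  using nijenhuis[of Z Y] by simp

lemma ad_JZ_nonzero: obtains U where "br (J Z) U \<noteq> 0"
proof -
  have "Z \<notin> a1 br J" using a1_trivial Z_nz by simp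
  then show ?thesis using that by (auto simp: a1_def)
qed

text \<open>A one-dimensional subspace contains no complex line. The proof reads this off the triviality of
  \<^term>\<open>a1 br J\<close>. It is applied to brackets \<open>X\<close> for which the integrability condition puts both \<open>X\<close>
  and \<open>J X\<close> in the centre.\<close>

lemma J_pair_in_centre_line:
  assumes "X \<in> span {Z}" "J X \<in> span {Z}" shows "X = 0"
proof -
  have "X \<in> g 1" "J X \<in> g 1" using assms by (simp_all only: centre)
  then have "X \<in> a1 br J" unfolding a1_def g_1_iff by blast
  then show ?thesis using a1_trivial by simp
qed

text \<open>Otherwise the image of \<open>ad (J Z)\<close> would be a \<open>J\<close>-invariant subspace of the centre, hence zero, and
  \<open>Z\<close> would lie in \<^term>\<open>a1 br J\<close>.\<close>

lemma JZ_notin_g_2: "J Z \<notin> g 2"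
proof
  assume "J Z \<in> g 2"
  then have "br (J Z) U = 0" for U
    by (intro J_pair_in_centre_line) (simp_all only: g_2_br ad_JZ_J[symmetric])
  then show False using ad_JZ_nonzero by metis
qed

text \<open>The largest \<open>J\<close>-invariant subspace of \<^term>\<open>g 2\<close>.\<close>

definition V :: "'a set" where "V = {v \<in> g 2. J v \<in> g 2}"

lemma subspace_V: "subspace V"
  using subspace_ascending_series[of 2] by (simp add: V_def real_vector.subspace_def)

lemma J_V: "v \<in> V \<Longrightarrow> J v \<in> V"
  using subspace_ascending_series[of 2] by (simp add: V_def real_vector.subspace_neg)

lemma V_br: "v \<in> V \<Longrightarrow> br v Y \<in> span {Z}" "v \<in> V \<Longrightarrow> br Y v \<in> span {Z}"
  using g_2_br[of v Y] bracket_skew[of Y v] by (auto simp: V_def real_vector.span_neg)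

lemma ad_JZ_V: assumes "v \<in> V" shows "br (J Z) v = 0"
  by (intro J_pair_in_centre_line) (simp_all only: V_br(2) J_V assms ad_JZ_J[symmetric])

text \<open>By nilpotency \<open>J Z\<close> enters the series at some level, which is above the second; the level
  just before it separates \<open>J Z\<close> from everything in \<^term>\<open>g 2\<close>.\<close>

lemma exists_separating_level:
  obtains m where "g 2 \<subseteq> g m" "J Z \<notin> g m" "J Z \<in> g (Suc m)"
proof -
  obtain n where n: "J Z \<in> g n" using nilpotent by (auto simp: nilpotent_lie_def)
  define k where "k = (LEAST k. J Z \<in> g k)"
  have k: "J Z \<in> g k" unfolding k_def using n by (rule LeastI)
  have "2 < k" using k JZ_notin_g_2 ascending_series_mono[of k 2] by (meson in_mono not_le)
  then have "J Z \<notin> g (k - 1)" unfolding k_def by (intro not_less_Least) (simp add: k_def)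
  then show ?thesis using that[of "k - 1"] k \<open>2 < k\<close> ascending_series_mono[of 2 "k - 1"]
    by (simp del: ascending_series.simps)
qed

text \<open>The image of \<open>ad (J Z)\<close> lies in the level \<open>m\<close> before the one where \<open>J Z\<close> appears, which contains
  \<open>V\<close> and \<open>Z\<close> but not \<open>J Z\<close>; this kills \<open>b\<close>. The image is \<open>J\<close>-invariant, and applying \<open>J\<close> moves the
  coefficient \<open>a\<close> to \<open>J Z\<close>, which kills \<open>a\<close>.\<close>

lemma ad_JZ_components:
  assumes "br (J Z) U = v + a *\<^sub>R Z + b *\<^sub>R J Z" "v \<in> V"
  shows "a = 0" "b = 0"
proof -
  obtain m where m: "g 2 \<subseteq> g m" "J Z \<notin> g m" "J Z \<in> g (Suc m)" using exists_separating_level .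
  have sub: "subspace (g m)" by (rule subspace_ascending_series)
  have vm: "v \<in> g m" "J v \<in> g m" using assms(2) m(1) J_V by (auto simp: V_def)
  have Zm: "Z \<in> g m" using m(1) Z_in_g[of 2] by auto
  have *: "c = 0" if "c *\<^sub>R J Z \<in> g m" for c
  proof (rule ccontr)
    assume "c \<noteq> 0"
    then show False using real_vector.subspace_scale[OF sub that, of "inverse c"] m(2) by simp
  qed
  have "br (J Z) U - v - a *\<^sub>R Z \<in> g m"
    using g_SucD[OF m(3)] vm Zm by (intro real_vector.subspace_diff[OF sub] real_vector.subspace_scale[OF sub])
  then show b: "b = 0" using * assms(1) by simp
  have "br (J Z) (J U) - J v \<in> g m"
    using g_SucD[OF m(3)] vm by (intro real_vector.subspace_diff[OF sub])
  then show "a = 0" using * assms(1) b by (simp add: ad_JZ_J)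
qed

lemma V_Int_ZJZ:
  assumes "a *\<^sub>R Z + b *\<^sub>R J Z \<in> V" shows "a = 0" "b = 0"
proof -
  have sub: "subspace (g 2)" by (rule subspace_ascending_series)
  have *: "c = 0" if "c *\<^sub>R J Z \<in> g 2" for c
  proof (rule ccontr)
    assume "c \<noteq> 0"
    then show False using real_vector.subspace_scale[OF sub that, of "inverse c"] JZ_notin_g_2 by simp
  qed
  have "(a *\<^sub>R Z + b *\<^sub>R J Z) - a *\<^sub>R Z \<in> g 2"
    using assms Z_in_g[of 2] by (intro real_vector.subspace_diff[OF sub] real_vector.subspace_scale[OF sub]) (auto simp: V_def)
  then show b: "b = 0" using * by simp
  have "J (a *\<^sub>R Z + b *\<^sub>R J Z) \<in> g 2" using assms by (simp add: V_def)
  then show "a = 0" using * b by simp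
qed

text \<open>This is the decisive step. The integrability condition expresses \<open>[J x, J y]\<close> through \<open>[x, y]\<close>,
  \<open>[J x, y]\<close> and \<open>[x, J y]\<close>, which are central when \<open>x\<close> and \<open>y\<close> are in \<^term>\<open>g 2\<close>. If \<^term>\<open>g 2\<close> and
  its image under \<open>J\<close> filled the algebra, all brackets would thus lie in the plane of \<open>Z\<close> and \<open>J Z\<close>, and
  the vanishing of the coefficients in \<open>ad_JZ_components\<close> with \<open>v = 0\<close> would make \<open>ad (J Z)\<close> vanish.\<close>

lemma g_2_plus_J_g_2: "{x + y |x y. x \<in> g 2 \<and> y \<in> J ` g 2} \<noteq> UNIV"
proof
  assume full: "{x + y |x y. x \<in> g 2 \<and> y \<in> J ` g 2} = UNIV"
  have JS: "J x \<in> span {Z, J Z}" if x: "x \<in> span {Z}" for x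
  proof -
    obtain k where "x = k *\<^sub>R Z" using x by (auto simp: real_vector.span_singleton)
    then show ?thesis by (simp add: real_vector.span_base real_vector.span_scale)
  qed
  have sub: "span {Z} \<subseteq> span {Z, J Z}" by (rule real_vector.span_mono) auto
  have br: "br X Y \<in> span {Z, J Z}" for X Y
  proof -
    obtain x x' where x: "x \<in> g 2" "x' \<in> g 2" "X = x + J x'" using full by blast
    obtain y y' where y: "y \<in> g 2" "y' \<in> g 2" "Y = y + J y'" using full by blast
    have in_Z: "br a b \<in> span {Z}" "br b a \<in> span {Z}" if "a \<in> g 2" for a b
      using g_2_br[OF that, of b] bracket_skew[of b a] by (auto simp: real_vector.span_neg)
    have "br (J x') (J y') = br x' y' + J (br (J x') y' + br x' (J y'))"
      using nijenhuis[of x' y'] by (simp add: algebra_simps)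
    also have "\<dots> \<in> span {Z, J Z}"
      using in_Z x y sub by (intro span_add JS) auto
    finally have "br (J x') (J y') \<in> span {Z, J Z}" .
    moreover have "br X Y = br x Y + br (J x') y + br (J x') (J y')" using x y by simp
    ultimately show ?thesis using in_Z x y sub by (metis span_add subsetD)
  qed
  obtain U where U: "br (J Z) U \<noteq> 0" using ad_JZ_nonzero .
  obtain a b where "br (J Z) U = 0 + a *\<^sub>R Z + b *\<^sub>R J Z"
    using br[of "J Z" U] by (auto simp: real_vector.span_breakdown_eq algebra_simps)
  then show False using ad_JZ_components[of U 0 a b] subspace_V U by (simp add: real_vector.subspace_0)
qed

text \<open>The actual dimension is four; the bound three already yields two vectors of \<open>V\<close> that are
  independent over the complex numbers, because a single complex line has real dimension two.\<close>

lemma dim_V: "dim V \<ge> 3"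
proof -
  let ?T = "J ` g 2"
  have sub: "subspace (g 2)" "subspace ?T"
    by (simp_all add: subspace_ascending_series linear_subspace_image[OF linear_J] del: ascending_series.simps)
  have pos: "0 < dim (UNIV :: 'a set)" using dim_g by simp
  have inj: "inj J" by (metis J_J injI minus_equation_iff)
  have "dim ?T = 5"
  proof -
    obtain C where C: "C \<subseteq> g 2" "independent C" "g 2 \<subseteq> span C" "card C = 5"
      using real_vector.basis_exists[of "g 2"] dim_g2 by metis
    have "independent (J ` C)"
      using linear_independent_injective_image[OF linear_J C(2) ] inj by (simp add: inj_on_subset)
    moreover have "span C = g 2" using C sub by (simp add: real_vector.span_minimal subset_antisym)
    then have "span (J ` C) = ?T" using linear_span_image[OF linear_J] by metis
    moreover have "card (J ` C) = 5" using C inj by (simp add: card_image inj_on_subset)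
    ultimately show ?thesis by (metis real_vector.dim_span_eq_card_independent)
  qed
  moreover have "g 2 \<inter> ?T = V"
  proof (intro set_eqI iffI)
    fix x assume "x \<in> g 2 \<inter> ?T"
    then show "x \<in> V" using real_vector.subspace_neg[OF sub(1)] by (auto simp: V_def)
  next
    fix x assume x: "x \<in> V"
    then have "- J x \<in> g 2" "J (- J x) = x" using real_vector.subspace_neg[OF sub(1)] by (auto simp: V_def)
    then show "x \<in> g 2 \<inter> ?T" using x unfolding V_def by (metis (mono_tags, lifting) Int_iff image_eqI mem_Collect_eq)
  qed
  moreover have "dim {x + y |x y. x \<in> g 2 \<and> y \<in> ?T} < 8"
  proof (rule ccontr)
    assume "\<not> ?thesis"
    then have "{x + y |x y. x \<in> g 2 \<and> y \<in> ?T} = UNIV"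
      using subspace_UNIV_if_dim[OF pos real_vector.subspace_sums[OF sub]] dim_g by simp
    then show False using g_2_plus_J_g_2 by simp
  qed
  ultimately show ?thesis using dim_sum_Int_real[OF pos sub] dim_g2 by simp
qed

end

section \<open>An adapted frame and the structure equations\<close>

context snn_lie_algebra
begin

text \<open>Two complex lines in \<open>V\<close> and the complex line of \<open>Z\<close> span a \<open>J\<close>-invariant subspace \<open>W\<close> of real
  codimension two. The vector \<open>e1\<close> is taken outside \<open>W\<close> but as deep in the central series as possible,
  in the first level that is not contained in \<open>W\<close>. Then all brackets with \<open>e1\<close> are in \<open>W\<close>, which gives
  \<open>d\<omega>\<^sup>1 = 0\<close>, and \<open>[J Z, e1]\<close> loses its components along \<open>Z\<close> and \<open>J Z\<close> by \<open>ad_JZ_components\<close>.\<close>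

lemma adapted_frame:
  obtains e1 e2 e3 where "e2 \<in> V" "e3 \<in> V"
    "independent (set [J e1, e1, J e2, e2, J e3, e3, J Z, Z])"
    "card (set [J e1, e1, J e2, e2, J e3, e3, J Z, Z]) = 8"
    "span (set [J e1, e1, J e2, e2, J e3, e3, J Z, Z]) = UNIV"
    "br e1 (J e1) \<in> span {J e2, e2, J e3, e3, J Z, Z}"
    "br (J Z) e1 \<in> span {J e2, e2, J e3, e3}"
proof -
  have pos: "0 < dim (UNIV :: 'a set)" using dim_g by simp
  \<comment> \<open>The spans below are those of \<open>Z\<close>, of \<open>Z, e2\<close>, of \<open>Z, e2, e3\<close> and of all four vectors, over the
    complex numbers; the span of \<open>?S3\<close> is \<open>W\<close>.\<close>
  let ?S1 = "{J Z, Z}"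
  have S1: "independent ?S1" "card ?S1 = 2" "\<And>y. y \<in> span ?S1 \<Longrightarrow> J y \<in> span ?S1"
    using adjoin_J_pair[of "{}" Z] Z_nz real_vector.independent_empty by (simp_all add: numeral_2_eq_2)
  have "\<not> V \<subseteq> span {}" using dim_V real_vector.dim_le_card[of V "{}"] by auto
  then obtain e2 where e2: "e2 \<in> V" "e2 \<noteq> 0" by auto
  have notin2: "e2 \<notin> span ?S1"
  proof
    assume "e2 \<in> span ?S1"
    then obtain a b where e2': "e2 = a *\<^sub>R Z + b *\<^sub>R J Z"
      by (auto simp: real_vector.span_breakdown_eq algebra_simps)
    then show False using V_Int_ZJZ[of a b] e2 by simp
  qed
  let ?S2 = "insert (J e2) (insert e2 ?S1)"
  have S2: "independent ?S2" "card ?S2 = 4" "\<And>y. y \<in> span ?S2 \<Longrightarrow> J y \<in> span ?S2"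
    using adjoin_J_pair[OF S1(1,3) notin2] S1(2) by simp_all
  have "\<not> V \<subseteq> span {J e2, e2}"
  proof
    assume "V \<subseteq> span {J e2, e2}"
    then have "dim V \<le> card {J e2, e2}" by (rule real_vector.dim_le_card) simp
    also have "\<dots> \<le> 2" by (simp add: card_insert_if)
    finally show False using dim_V by simp
  qed
  then obtain e3 where e3: "e3 \<in> V" "e3 \<notin> span {J e2, e2}" by auto
  have span_V: "span {J e2, e2} \<subseteq> V"
    using e2 J_V subspace_V by (intro real_vector.span_minimal) auto
  have notin3: "e3 \<notin> span ?S2"
  proof
    assume "e3 \<in> span ?S2"
    then obtain p q a b where "e3 - p *\<^sub>R J e2 - q *\<^sub>R e2 - b *\<^sub>R J Z - a *\<^sub>R Z = 0"
      by (auto simp: real_vector.span_breakdown_eq)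
    then have e3': "e3 = (p *\<^sub>R J e2 + q *\<^sub>R e2) + (a *\<^sub>R Z + b *\<^sub>R J Z)" by (simp add: algebra_simps)
    have pq: "p *\<^sub>R J e2 + q *\<^sub>R e2 \<in> span {J e2, e2}"
      by (intro span_add span_scale span_base) auto
    then have "e3 - (p *\<^sub>R J e2 + q *\<^sub>R e2) \<in> V"
      using span_V e3(1) by (intro real_vector.subspace_diff[OF subspace_V]) auto
    then have "a *\<^sub>R Z + b *\<^sub>R J Z \<in> V" using e3' by simp
    then have "e3 \<in> span {J e2, e2}" using V_Int_ZJZ[of a b] e3' pq by simp
    then show False using e3(2) by simp
  qed
  let ?S3 = "insert (J e3) (insert e3 ?S2)"
  have S3: "independent ?S3" "card ?S3 = 6" "\<And>y. y \<in> span ?S3 \<Longrightarrow> J y \<in> span ?S3"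
    using adjoin_J_pair[OF S2(1,3) notin3] S2(2) by simp_all
  have "\<not> UNIV \<subseteq> span ?S3"
    using real_vector.dim_le_card[of UNIV ?S3] S3(2) dim_g by auto
  moreover obtain n where "g n = UNIV" using nilpotent by (auto simp: nilpotent_lie_def)
  ultimately have ex: "\<not> g n \<subseteq> span ?S3" by simp
  define k where "k = (LEAST k. \<not> g k \<subseteq> span ?S3)"
  have k: "\<not> g k \<subseteq> span ?S3" unfolding k_def using ex by (rule LeastI)
  have "g 0 \<subseteq> span ?S3" by (simp add: real_vector.span_zero)
  then have "k \<noteq> 0" using k by metis
  then have "g (k - 1) \<subseteq> span ?S3"
    using not_less_Least[of "k - 1" "\<lambda>k. \<not> g k \<subseteq> span ?S3"] by (auto simp: k_def)
  moreover obtain e1 where e1: "e1 \<in> g k" "e1 \<notin> span ?S3" using k by blast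
  ultimately have br_e1: "br e1 Y \<in> span ?S3" for Y
    using g_SucD[of e1 "k - 1" Y] \<open>k \<noteq> 0\<close> by auto
  let ?S4 = "insert (J e1) (insert e1 ?S3)"
  have S4: "independent ?S4" "card ?S4 = 8"
    using adjoin_J_pair[OF S3(1,3) e1(2)] S3(2) by simp_all
  have "dim (span ?S4) = 8" using S4 real_vector.dim_span_eq_card_independent by metis
  then have "span ?S4 = UNIV"
    using subspace_UNIV_if_dim[OF pos real_vector.subspace_span] dim_g by simp
  moreover have perm3: "?S3 = {J e2, e2, J e3, e3, J Z, Z}" by auto
  then have perm: "?S4 = set [J e1, e1, J e2, e2, J e3, e3, J Z, Z]" by auto
  moreover have "br (J Z) e1 \<in> span {J e2, e2, J e3, e3}"
  proof -
    have "br (J Z) e1 \<in> span ?S3" using real_vector.span_neg[OF br_e1[of "J Z"]] bracket_skew[of "J Z" e1] by simp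
    then obtain p q p' q' a b where
      *: "br (J Z) e1 - p' *\<^sub>R J e3 - q' *\<^sub>R e3 - p *\<^sub>R J e2 - q *\<^sub>R e2 - b *\<^sub>R J Z - a *\<^sub>R Z = 0"
      by (auto simp: real_vector.span_breakdown_eq)
    define v where "v = p' *\<^sub>R J e3 + q' *\<^sub>R e3 + p *\<^sub>R J e2 + q *\<^sub>R e2"
    have v: "v \<in> span {J e2, e2, J e3, e3}"
      unfolding v_def by (intro span_add span_scale span_base) auto
    moreover have "span {J e2, e2, J e3, e3} \<subseteq> V"
      using e2 e3 J_V subspace_V by (intro real_vector.span_minimal) auto
    moreover have eq: "br (J Z) e1 = v + a *\<^sub>R Z + b *\<^sub>R J Z" using * by (simp add: v_def algebra_simps)
    ultimately have "a = 0" "b = 0" using ad_JZ_components[OF eq] by auto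
    then show ?thesis using v eq by simp
  qed
  ultimately show ?thesis
    using that[OF e2(1) e3(1)] S4 br_e1[of "J e1"] by (metis perm3)
qed

lemma V_bracket_scalar:
  assumes "v \<in> V" obtains p where "br v Y = p *\<^sub>R Z"
  using V_br(1)[OF assms, of Y] by (auto simp: real_vector.span_singleton)

text \<open>The two sums \<open>[J v, u] + [v, J u]\<close> and \<open>[J v, J u] - [v, u]\<close> are central, and by integrability
  \<open>J\<close> maps the first to the second. Hence both vanish: bracketing with \<open>V\<close> is a form of type \<open>(1,1)\<close>.\<close>

lemma V_bracket_type11:
  assumes "v \<in> V" shows "br (J v) u = - br v (J u)" "br (J v) (J u) = br v u"
proof -
  let ?T = "br (J v) u + br v (J u)"
  have JT: "J ?T = br (J v) (J u) - br v u"
    using nijenhuis[of v u] by (simp add: algebra_simps)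
  have "?T \<in> span {Z}" "J ?T \<in> span {Z}"
    unfolding JT using V_br J_V assms by (simp_all add: real_vector.span_add real_vector.span_diff)
  then have T: "?T = 0" by (rule J_pair_in_centre_line)
  then show "br (J v) u = - br v (J u)" by (simp add: eq_neg_iff_add_eq_0)
  show "br (J v) (J u) = br v u" using JT T by simp
qed

text \<open>A real form of type \<open>(1,1)\<close>, restricted to two complex lines, is governed by one complex number.
  The second equation reads the same \<open>h\<close> with the arguments exchanged; it is why the coefficients of
  \<open>d\<omega>\<^sup>4\<close> come in pairs such as \<open>M\<close> and \<open>- cnj M\<close>.\<close>

lemma V_bracket_hermitian:
  assumes "v \<in> V"
  obtains h where "\<And>x y. br (cmul x v) (cmul y u) = Re (x * cnj y * h) *\<^sub>R Z"
    "\<And>x y. br (cmul x u) (cmul y v) = - Re (y * cnj x * h) *\<^sub>R Z"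
proof -
  obtain p where p: "br v u = p *\<^sub>R Z" using V_bracket_scalar[OF assms] .
  obtain q where q: "br v (J u) = q *\<^sub>R Z" using V_bracket_scalar[OF assms] .
  have *: "br (cmul x v) (cmul y u) = Re (x * cnj y * Complex p (- q)) *\<^sub>R Z" for x y
    by (simp add: cmul_def V_bracket_type11[OF assms] p q algebra_simps)
  have "br (cmul x u) (cmul y v) = - Re (y * cnj x * Complex p (- q)) *\<^sub>R Z" for x y
    using *[of y x] bracket_skew[of "cmul x u" "cmul y v"] by (simp only: scaleR_minus_left)
  with * show ?thesis using that by blast
qed

lemma br_cmul_self: "br (cmul x e) (cmul y e) = Im (x * cnj y) *\<^sub>R br e (J e)"
  using bracket_skew[of "J e" e] by (simp add: cmul_def algebra_simps)

lemma br_cmul_Z: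
  "br (cmul x Z) (cmul y e) = - Im x *\<^sub>R cmul y (br (J Z) e)"
  "br (cmul y e) (cmul x Z) = Im x *\<^sub>R cmul y (br (J Z) e)"
proof -
  show *: "br (cmul x Z) (cmul y e) = - Im x *\<^sub>R cmul y (br (J Z) e)"
    by (simp add: cmul_def ad_JZ_J algebra_simps)
  show "br (cmul y e) (cmul x Z) = Im x *\<^sub>R cmul y (br (J Z) e)"
    using bracket_skew[of "cmul y e" "cmul x Z"] * by simp
qed

lemma normal_form:
  "\<exists>w1 w2 w3 w4 A B E F L M N P s t.
     basis10 J [w1, w2, w3, w4] \<and> structure_eqs br w1 w2 w3 w4 A B E F L M N P s t"
proof -
  obtain e1 e2 e3 where e: "e2 \<in> V" "e3 \<in> V"
    "independent (set [J e1, e1, J e2, e2, J e3, e3, J Z, Z])"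
    "card (set [J e1, e1, J e2, e2, J e3, e3, J Z, Z]) = 8"
    "span (set [J e1, e1, J e2, e2, J e3, e3, J Z, Z]) = UNIV"
    "br e1 (J e1) \<in> span {J e2, e2, J e3, e3, J Z, Z}"
    "br (J Z) e1 \<in> span {J e2, e2, J e3, e3}"
    using adapted_frame by metis
  obtain w1 w2 w3 w4 where w: "w1 \<in> forms10 J" "w2 \<in> forms10 J" "w3 \<in> forms10 J" "w4 \<in> forms10 J"
    and v1: "w1 e1 = 1" "w1 e2 = 0" "w1 e3 = 0" "w1 Z = 0"
    and v2: "w2 e1 = 0" "w2 e2 = 1" "w2 e3 = 0" "w2 Z = 0"
    and v3: "w3 e1 = 0" "w3 e2 = 0" "w3 e3 = 1" "w3 Z = 0"
    and v4: "w4 e1 = 0" "w4 e2 = 0" "w4 e3 = 0" "w4 Z = 1"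
    and X: "\<And>X. X = cmul (w1 X) e1 + cmul (w2 X) e2 + cmul (w3 X) e3 + cmul (w4 X) Z"
    using dual_frame[OF e(3-5)] by metis
  have lin: "linear w1" "linear w2" "linear w3" "linear w4"
    using w by (simp_all add: forms10_iff)
  have wJ: "w1 (J x) = - \<i> * w1 x" "w4 (J x) = - \<i> * w4 x" for x
    using w by (simp_all add: forms10_iff)
  have basis: "basis10 J [w1, w2, w3, w4]"
    using w v1 v2 v3 v4 X by (rule basis10_of_dual)
  \<comment> \<open>The brackets \<open>c\<close> and \<open>d\<close> hold all information outside the centre: their coordinates give the
    coefficients of \<open>\<omega>\<^sup>1 \<and> cnj \<omega>\<^sup>1\<close> and of \<open>\<omega>\<^sup>1 \<and> (\<omega>\<^sup>4 - cnj \<omega>\<^sup>4)\<close>.\<close>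
  define c where "c = br e1 (J e1)"
  define d where "d = br (J Z) e1"
  have "w1 c = 0"
    by (rule linear_eq_0_on_span[OF lin(1) _ e(6)[folded c_def]]) (auto simp: wJ v1)
  have "w1 d = 0"
    by (rule linear_eq_0_on_span[OF lin(1) _ e(7)[folded d_def]]) (auto simp: wJ v1)
  have "w4 d = 0"
    by (rule linear_eq_0_on_span[OF lin(4) _ e(7)[folded d_def]]) (auto simp: wJ v4)
  obtain h21 where h21: "\<And>x y. br (cmul x e2) (cmul y e1) = Re (x * cnj y * h21) *\<^sub>R Z"
    "\<And>x y. br (cmul x e1) (cmul y e2) = - Re (y * cnj x * h21) *\<^sub>R Z"
    using V_bracket_hermitian[OF e(1)] by metis
  obtain h31 where h31: "\<And>x y. br (cmul x e3) (cmul y e1) = Re (x * cnj y * h31) *\<^sub>R Z"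
    "\<And>x y. br (cmul x e1) (cmul y e3) = - Re (y * cnj x * h31) *\<^sub>R Z"
    using V_bracket_hermitian[OF e(2)] by metis
  obtain h32 where h32: "\<And>x y. br (cmul x e3) (cmul y e2) = Re (x * cnj y * h32) *\<^sub>R Z"
    "\<And>x y. br (cmul x e2) (cmul y e3) = - Re (y * cnj x * h32) *\<^sub>R Z"
    using V_bracket_hermitian[OF e(2)] by metis
  obtain t2 where t2: "br e2 (J e2) = t2 *\<^sub>R Z" using V_bracket_scalar[OF e(1)] .
  obtain t3 where t3: "br e3 (J e3) = t3 *\<^sub>R Z" using V_bracket_scalar[OF e(2)] .
  \<comment> \<open>The real, central part of the bracket that involves \<open>V\<close>.\<close>
  define lam where "lam X Y =
      Re (w2 X * cnj (w1 Y) * h21) - Re (w2 Y * cnj (w1 X) * h21)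
    + Re (w3 X * cnj (w1 Y) * h31) - Re (w3 Y * cnj (w1 X) * h31)
    + Re (w3 X * cnj (w2 Y) * h32) - Re (w3 Y * cnj (w2 X) * h32)
    + Im (w2 X * cnj (w2 Y)) * t2 + Im (w3 X * cnj (w3 Y)) * t3" for X Y
  have br: "br X Y = Im (w1 X * cnj (w1 Y)) *\<^sub>R c
      + cmul (of_real (Im (w4 Y)) * w1 X - of_real (Im (w4 X)) * w1 Y) d + lam X Y *\<^sub>R Z" for X Y
  proof -
    have d0: "br (J Z) e2 = 0" "br (J Z) e3 = 0" using ad_JZ_V e by simp_all
    have cm: "cmul (of_real (Im (w4 Y)) * w1 X - of_real (Im (w4 X)) * w1 Y) d
      = Im (w4 Y) *\<^sub>R cmul (w1 X) d - Im (w4 X) *\<^sub>R cmul (w1 Y) d"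
      by (simp add: cmul_def algebra_simps)
    have "br X Y = br (cmul (w1 X) e1 + cmul (w2 X) e2 + cmul (w3 X) e3 + cmul (w4 X) Z)
       (cmul (w1 Y) e1 + cmul (w2 Y) e2 + cmul (w3 Y) e3 + cmul (w4 Y) Z)"
      by (simp only: X[symmetric])
    also have "\<dots> = Im (w1 X * cnj (w1 Y)) *\<^sub>R c
      + (Im (w4 Y) *\<^sub>R cmul (w1 X) d - Im (w4 X) *\<^sub>R cmul (w1 Y) d) + lam X Y *\<^sub>R Z"
      unfolding bilinear_ladd[OF bilinear_bracket] bilinear_radd[OF bilinear_bracket]
        br_cmul_self br_cmul_Z h21 h31 h32 c_def[symmetric] d_def[symmetric] t2 t3 d0
      by (simp add: lam_def scaleR_add_left scaleR_diff_left del: times_complex.sel)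
    finally show ?thesis unfolding cm .
  qed
  have w_br: "u (br X Y) = of_real (Im (w1 X * cnj (w1 Y))) * u c
      + (of_real (Im (w4 Y)) * w1 X - of_real (Im (w4 X)) * w1 Y) * u d + of_real (lam X Y) * u Z"
    if "u \<in> forms10 J" for u X Y
  proof -
    have "linear u" using that by (simp add: forms10_iff)
    then show ?thesis unfolding br
      by (simp only: linear_add linear_cmul form10_cmul[OF that] scaleR_conv_of_real)
  qed
  \<comment> \<open>With \<open>z = \<omega>\<^sup>1 X * cnj (\<omega>\<^sup>1 Y)\<close>, the form \<open>\<omega>\<^sup>1 \<and> cnj \<omega>\<^sup>1\<close> takes the value \<open>z - cnj z\<close>, which is
    \<open>2 i Im z\<close>, and \<open>\<omega>\<^sup>4 - cnj \<omega>\<^sup>4\<close> is \<open>2 i Im \<omega>\<^sup>4\<close>. This is where the factors \<open>i / 2\<close> come from.\<close>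
  let ?A = "\<lambda>u::'a \<Rightarrow> complex. \<i> * u c / 2" and ?B = "\<lambda>u::'a \<Rightarrow> complex. - \<i> * u d / 2"
  have "structure_eqs br w1 w2 w3 w4 (?A w2) (?B w2) (?B w3) (?A w3) (?A w4)
     (cnj h21 / 2) (cnj h31 / 2) (cnj h32 / 2) (t2 / 2) (t3 / 2)"
    unfolding structure_eqs_def
  proof (intro allI conjI)
    fix X Y
    show "d1 br w1 X Y = 0"
      by (simp add: d1_def w_br[OF w(1)] \<open>w1 c = 0\<close> \<open>w1 d = 0\<close> v1)
    have gen: "d1 br u X Y = ?A u * (w1 \<^bold>\<and> form_cnj w1) X Y
        - ?B u * ((w1 \<^bold>\<and> w4) X Y - (w1 \<^bold>\<and> form_cnj w4) X Y)" if "u \<in> forms10 J" "u Z = 0" for u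
      unfolding d1_def w_br[OF that(1)] that(2)
      by (simp add: wedge_def form_cnj_def complex_eq_iff field_simps)
    show "d1 br w2 X Y = ?A w2 * (w1 \<^bold>\<and> form_cnj w1) X Y
        - ?B w2 * ((w1 \<^bold>\<and> w4) X Y - (w1 \<^bold>\<and> form_cnj w4) X Y)" by (rule gen[OF w(2) v2(4)])
    show "d1 br w3 X Y = ?A w3 * (w1 \<^bold>\<and> form_cnj w1) X Y
        - ?B w3 * ((w1 \<^bold>\<and> w4) X Y - (w1 \<^bold>\<and> form_cnj w4) X Y)" by (rule gen[OF w(3) v3(4)])
    show "d1 br w4 X Y = ?A w4 * (w1 \<^bold>\<and> form_cnj w1) X Y
                     + cnj h21 / 2 * (w1 \<^bold>\<and> form_cnj w2) X Y
                     + cnj h31 / 2 * (w1 \<^bold>\<and> form_cnj w3) X Y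
                     - cnj (cnj h21 / 2) * (w2 \<^bold>\<and> form_cnj w1) X Y
                     + \<i> * complex_of_real (t2 / 2) * (w2 \<^bold>\<and> form_cnj w2) X Y
                     + cnj h32 / 2 * (w2 \<^bold>\<and> form_cnj w3) X Y
                     - cnj (cnj h31 / 2) * (w3 \<^bold>\<and> form_cnj w1) X Y
                     - cnj (cnj h32 / 2) * (w3 \<^bold>\<and> form_cnj w2) X Y
                     + \<i> * complex_of_real (t3 / 2) * (w3 \<^bold>\<and> form_cnj w3) X Y"
      unfolding d1_def w_br[OF w(4)] v4 \<open>w4 d = 0\<close> lam_def
      by (simp add: wedge_def form_cnj_def complex_eq_iff field_simps)
  qed
  with basis show ?thesis by blast
qed

end

section \<open>The real part of L and the third term of the series\<close>

lemma (in almost_complex) basis10_form10: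
  assumes "basis10 J ws" "w \<in> set ws" shows "w \<in> forms10 J"
  using assms cform.span_base unfolding basis10_def by blast

lemma (in almost_complex) basis10_joint_kernel:
  assumes "basis10 J ws" "\<And>w. w \<in> set ws \<Longrightarrow> w X = 0" shows "X = 0"
proof (rule forms10_separate)
  fix u assume "u \<in> forms10 J"
  then have "u \<in> cform.span (set ws)" using assms(1) by (simp add: basis10_def)
  then show "u X = 0" using not_in_cspan[of u X "set ws"] assms(2) by blast
qed

lemma (in lie_algebra) ascending_type_entries:
  assumes "nilpotent_lie bracket" "ascending_type bracket = ns"
  shows "ascending_series bracket (length ns) = UNIV"
    and "k < length ns \<Longrightarrow> dim (ascending_series bracket (Suc k)) = ns ! k"
proof -
  let ?r = "nilpotency_step bracket"
  have len: "length ns = ?r" unfolding assms(2)[symmetric] by (simp add: ascending_type_def)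
  obtain n where n: "ascending_series bracket n = UNIV" using assms(1) by (auto simp: nilpotent_lie_def)
  then have "Suc n \<ge> 1 \<and> ascending_series bracket (Suc n) = UNIV" by simp
  then have "?r \<ge> 1 \<and> ascending_series bracket ?r = UNIV"
    unfolding nilpotency_step_def by (rule LeastI)
  then show "ascending_series bracket (length ns) = UNIV" using len by simp
  show "dim (ascending_series bracket (Suc k)) = ns ! k" if "k < length ns"
    using that unfolding len unfolding assms(2)[symmetric] ascending_type_def
    by (simp del: upt_Suc ascending_series.simps)
qed

text \<open>The imaginary part of \<open>d\<omega>\<^sup>4\<close> is \<open>Re L\<close> times that of \<open>\<omega>\<^sup>1 \<and> cnj \<omega>\<^sup>1\<close>, because the remaining terms
  add up to a real form. On the other hand \<^term>\<open>g 2\<close> contains the joint kernel \<open>K\<close> of \<open>\<omega>\<^sup>1\<close> and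
  \<open>Im \<omega>\<^sup>4\<close>. So if \<open>Re L = 0\<close> then all brackets are in \<open>K\<close>, hence in \<^term>\<open>g 2\<close>. If \<open>Re L \<noteq> 0\<close>, some bracket
  has \<open>\<omega>\<^sup>1 = 0\<close> and \<open>Im \<omega>\<^sup>4 \<noteq> 0\<close>; were it in \<^term>\<open>g 2\<close>, then \<^term>\<open>g 2\<close> would contain the kernel of \<open>\<omega>\<^sup>1\<close>,
  whose dimension is six.\<close>

lemma (in snn_lie_algebra) g_3_full_iff_Re_L:
  assumes basis: "basis10 J [w1, w2, w3, w4]"
    and eqs: "structure_eqs br w1 w2 w3 w4 A B E F L M N P s t"
  shows "g 3 = UNIV \<longleftrightarrow> Re L = 0"
proof -
  have forms: "w1 \<in> forms10 J" "w2 \<in> forms10 J" "w3 \<in> forms10 J" "w4 \<in> forms10 J"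
    using basis10_form10[OF basis] by simp_all
  have lin: "linear w1" "linear w4" using forms by (simp_all add: forms10_iff)
  have w_br: "w1 (br X Y) = 0"
    "w2 (br X Y) = - A * (w1 X * cnj (w1 Y) - w1 Y * cnj (w1 X))
       + 2 * \<i> * B * (of_real (Im (w4 Y)) * w1 X - of_real (Im (w4 X)) * w1 Y)"
    "w3 (br X Y) = - F * (w1 X * cnj (w1 Y) - w1 Y * cnj (w1 X))
       + 2 * \<i> * E * (of_real (Im (w4 Y)) * w1 X - of_real (Im (w4 X)) * w1 Y)"
    "Im (w4 (br X Y)) = - 2 * Re L * Im (w1 X * cnj (w1 Y))"
    "w1 X = 0 \<Longrightarrow> w2 X = 0 \<Longrightarrow> w3 X = 0 \<Longrightarrow> w4 (br X Y) = 0" for X Y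
  proof -
    have e: "u (br X Y) = - d1 br u X Y" for u :: "'a \<Rightarrow> complex" by (simp add: d1_def)
    note eqs' = eqs[unfolded structure_eqs_def, rule_format, of X Y]
    show "w1 (br X Y) = 0" using eqs' by (simp add: e)
    show "w2 (br X Y) = - A * (w1 X * cnj (w1 Y) - w1 Y * cnj (w1 X))
       + 2 * \<i> * B * (of_real (Im (w4 Y)) * w1 X - of_real (Im (w4 X)) * w1 Y)"
      unfolding e using eqs' by (simp add: wedge_def form_cnj_def complex_eq_iff field_simps)
    show "w3 (br X Y) = - F * (w1 X * cnj (w1 Y) - w1 Y * cnj (w1 X))
       + 2 * \<i> * E * (of_real (Im (w4 Y)) * w1 X - of_real (Im (w4 X)) * w1 Y)"
      unfolding e using eqs' by (simp add: wedge_def form_cnj_def complex_eq_iff field_simps)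
    show "Im (w4 (br X Y)) = - 2 * Re L * Im (w1 X * cnj (w1 Y))"
      unfolding e eqs'[THEN conjunct2, THEN conjunct2, THEN conjunct2]
      by (simp add: wedge_def form_cnj_def field_simps)
    show "w4 (br X Y) = 0" if "w1 X = 0" "w2 X = 0" "w3 X = 0"
      unfolding e using eqs' that by (simp add: wedge_def form_cnj_def)
  qed
  have g1: "X \<in> g 1" if X: "w1 X = 0" "w2 X = 0" "w3 X = 0" "Im (w4 X) = 0" for X
    unfolding g_1_iff
    by (intro allI basis10_joint_kernel[OF basis]) (auto simp: w_br X)
  have g2: "X \<in> g 2" if X: "w1 X = 0" "Im (w4 X) = 0" for X
  proof -
    have "br X Y \<in> g 1" for Y by (rule g1) (simp_all add: w_br X)
    then show ?thesis by (simp add: numeral_2_eq_2)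
  qed
  show ?thesis
  proof
    assume "Re L = 0"
    then have "br X Y \<in> g 2" for X Y by (intro g2) (simp_all add: w_br)
    then show "g 3 = UNIV" by (simp add: numeral_3_eq_3 numeral_2_eq_2)
  next
    assume g3: "g 3 = UNIV"
    show "Re L = 0"
    proof (rule ccontr)
      assume L: "Re L \<noteq> 0"
      have "w1 \<noteq> 0" using basis cform.dependent_zero[of "set [w1, w2, w3, w4]"] by (auto simp: basis10_def)
      then obtain X0 where X0: "w1 X0 \<noteq> 0" by (auto simp: fun_eq_iff)
      define U where "U = br X0 (J X0)"
      have "Im (w1 X0 * cnj (w1 (J X0))) = (cmod (w1 X0))\<^sup>2"
        using forms(1) by (simp add: forms10_iff cmod_power2) (simp add: power2_eq_square)
      then have "Im (w4 U) = - 2 * Re L * (cmod (w1 X0))\<^sup>2"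
        unfolding U_def w_br by simp
      then have U: "Im (w4 U) \<noteq> 0" "w1 U = 0" using L X0 by (simp_all add: U_def w_br)
      have "U \<in> g 2" using g_SucD[of X0 2] g3 by (simp add: U_def)
      have ker: "X \<in> g 2" if "w1 X = 0" for X
      proof -
        define r where "r = Im (w4 X) / Im (w4 U)"
        have "X - r *\<^sub>R U \<in> g 2"
          using that U by (intro g2) (simp_all add: r_def linear_diff lin linear_cmul)
        then have "(X - r *\<^sub>R U) + r *\<^sub>R U \<in> g 2"
          using \<open>U \<in> g 2\<close> subspace_ascending_series[of 2]
          by (intro real_vector.subspace_add real_vector.subspace_scale)
        then show ?thesis by simp
      qed
      have "X \<in> span (insert X0 (insert (J X0) (g 2)))" for X
      proof -
        define z where "z = w1 X / w1 X0"
        have "w1 (X - cmul z X0) = 0"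
          using X0 by (simp add: linear_diff lin form10_cmul[OF forms(1)] z_def)
        then have "X - cmul z X0 \<in> g 2" by (rule ker)
        moreover have "X = (X - cmul z X0) + (Re z *\<^sub>R X0 - Im z *\<^sub>R J X0)" by (simp add: cmul_def)
        ultimately show ?thesis
          by (metis insertI1 insertI2 span_add span_base span_diff span_scale)
      qed
      then have "span (insert X0 (insert (J X0) (g 2))) = UNIV" by blast
      then have "dim (insert X0 (insert (J X0) (g 2))) = 8" by (metis dim_g real_vector.dim_span)
      moreover have "dim (insert X0 (insert (J X0) (g 2))) \<le> 7"
        using dim_insert_le[of X0 "insert (J X0) (g 2)"] dim_insert_le[of "J X0" "g 2"] dim_g dim_g2 by simp
      ultimately show False by simp
    qed
  qed
qed

section \<open>The classification\<close>

theorem proposition4p14: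
  fixes br :: "'a::real_vector \<Rightarrow> 'a \<Rightarrow> 'a" and J :: "'a \<Rightarrow> 'a"
  assumes "lie_algebra br"
    and "dim (UNIV :: 'a set) = 8"
    and "nilpotent_lie br"
    and "strongly_non_nilpotent br J"
    and "dim (ascending_series br 1) = 1"
    and "dim (ascending_series br 2) = 5"
  shows "(\<exists>w1 w2 w3 w4 A B E F L M N P s t.
            basis10 J [w1, w2, w3, w4] \<and>
            structure_eqs br w1 w2 w3 w4 A B E F L M N P s t \<and>
            (\<forall>w\<in>{w1, w2, w3, w4}. \<forall>X Y Z. d2 br (d1 br w) X Y Z = 0)) \<and>
         (\<forall>w1 w2 w3 w4 A B E F L M N P s t.
            basis10 J [w1, w2, w3, w4] \<and>
            structure_eqs br w1 w2 w3 w4 A B E F L M N P s t \<longrightarrow>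
            (ascending_type br = [1, 5, 8] \<longrightarrow> Re L = 0) \<and>
            (ascending_type br = [1, 5, 6, 8] \<longrightarrow> Re L \<noteq> 0))"
proof -
  interpret lie_algebra br by fact
  obtain C where C: "C \<subseteq> ascending_series br 1" "independent C" "ascending_series br 1 \<subseteq> span C" "card C = 1"
    using real_vector.basis_exists[of "ascending_series br 1"] assms(5) by metis
  obtain Z where Z: "C = {Z}" using C(4) by (rule card_1_singletonE)
  have "Z \<noteq> 0" using C(2) Z real_vector.dependent_zero by auto
  have "ascending_series br 1 = span {Z}"
    using C(1,3) Z real_vector.span_minimal[OF _ subspace_ascending_series[of 1], of "{Z}"] by auto
  then interpret snn_lie_algebra br J Z
    using assms \<open>Z \<noteq> 0\<close>
    by (intro snn_lie_algebra.intro almost_complex.intro snn_lie_algebra_axioms.intro)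
      (auto simp: strongly_non_nilpotent_def complex_structure_def)
  have "d2 br (d1 br w) X Y Z = 0" if "basis10 J ws" "w \<in> set ws" for ws w X Y Z
    using basis10_form10[OF that] d2_d1_eq_0 by (simp add: forms10_iff)
  then have "\<exists>w1 w2 w3 w4 A B E F L M N P s t.
            basis10 J [w1, w2, w3, w4] \<and>
            structure_eqs br w1 w2 w3 w4 A B E F L M N P s t \<and>
            (\<forall>w\<in>{w1, w2, w3, w4}. \<forall>X Y Z. d2 br (d1 br w) X Y Z = 0)"
    using normal_form by (metis list.set(1,2))
  moreover have "g 3 = UNIV" if "ascending_type br = [1, 5, 8]"
    using ascending_type_entries(1)[OF nilpotent that] by (simp add: numeral_3_eq_3)
  moreover have "g 3 \<noteq> UNIV" if "ascending_type br = [1, 5, 6, 8]"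
    using ascending_type_entries(2)[OF nilpotent that, of 2] dim_g
    by (auto simp: numeral_3_eq_3 numeral_2_eq_2 simp del: ascending_series.simps)
  ultimately show ?thesis using g_3_full_iff_Re_L by blast
qed

end
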